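(* Let $X$ be a scheme which has an affine open covering such that the intersection of any two elements of this covering is quasi-compact. Then the underlying space of $X$ is Hausdorff if and only if every point of $X$ is a closed point.
   Context: Standard notions of scheme theory. An affine open covering of $X$ is a covering of $X$ by open subsets which are affine schemes. *)

theory Defs
  imports "HOL-Analysis.T1_Spaces" "HOL-Algebra.QuotRing"
begin

section \<open>Local rings and localization\<close>

definition local_ring :: "('a, 'm) ring_scheme \<Rightarrow> bool" where
  "local_ring R \<longleftrightarrow> cring R \<and> (\<exists>!M. maximalideal M R)"

definition local_ring_hom ::
    "('a, 'm) ring_scheme \<Rightarrow> ('b, 'n) ring_scheme \<Rightarrow> ('a \<Rightarrow> 'b) set" where
  "local_ring_hom R S =
     {h \<in> ring_hom R S.
        \<forall>M N. maximalideal M R \<and> maximalideal N S \<longrightarrow> {a \<in> carrier R. h a \<in> N} = M}"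

text \<open>The fraction \<open>a/s\<close>, as an equivalence class of pairs, in the localization of \<open>R\<close> at a
  multiplicatively closed subset \<open>S\<close>.\<close>

definition fraction ::
    "('a, 'm) ring_scheme \<Rightarrow> 'a set \<Rightarrow> 'a \<Rightarrow> 'a \<Rightarrow> ('a \<times> 'a) set" where
  "fraction R S a s =
     {(b, t). b \<in> carrier R \<and> t \<in> S \<and>
        (\<exists>u \<in> S. u \<otimes>\<^bsub>R\<^esub> ((a \<otimes>\<^bsub>R\<^esub> t) \<ominus>\<^bsub>R\<^esub> (b \<otimes>\<^bsub>R\<^esub> s)) = \<zero>\<^bsub>R\<^esub>)}"

text \<open>As for quotient groups in HOL-Algebra, operations on equivalence classes are unions over all
  representatives (here of sets that coincide).\<close>

definition localization ::
    "('a, 'm) ring_scheme \<Rightarrow> 'a set \<Rightarrow> ('a \<times> 'a) set ring" where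
  "localization R S =
    \<lparr>carrier = {fraction R S a s | a s. a \<in> carrier R \<and> s \<in> S},
     mult = (\<lambda>A B. \<Union>(a, s) \<in> A. \<Union>(b, t) \<in> B. fraction R S (a \<otimes>\<^bsub>R\<^esub> b) (s \<otimes>\<^bsub>R\<^esub> t)),
     one = fraction R S \<one>\<^bsub>R\<^esub> \<one>\<^bsub>R\<^esub>,
     zero = fraction R S \<zero>\<^bsub>R\<^esub> \<one>\<^bsub>R\<^esub>,
     add = (\<lambda>A B. \<Union>(a, s) \<in> A. \<Union>(b, t) \<in> B.
              fraction R S ((a \<otimes>\<^bsub>R\<^esub> t) \<oplus>\<^bsub>R\<^esub> (b \<otimes>\<^bsub>R\<^esub> s)) (s \<otimes>\<^bsub>R\<^esub> t))\<rparr>"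


section \<open>Ringed spaces\<close>

text \<open>\<open>sections X U\<close> is the ring of sections over the open set \<open>U\<close>, and \<open>restr X U V\<close> restricts
  sections from \<open>U\<close> to \<open>V \<subseteq> U\<close>. Values at sets that are not open carry no meaning.\<close>

record ('a, 'b) space_with_rings =
  underlying :: "'a topology"
  sections :: "'a set \<Rightarrow> 'b ring"
  restr :: "'a set \<Rightarrow> 'a set \<Rightarrow> 'b \<Rightarrow> 'b"

locale presheaf_of_rings =
  fixes X :: "('a, 'b) space_with_rings"
  assumes sections_cring: "openin (underlying X) U \<Longrightarrow> cring (sections X U)"
    and restr_hom:
      "\<lbrakk>openin (underlying X) U; openin (underlying X) V; V \<subseteq> U\<rbrakk>
        \<Longrightarrow> restr X U V \<in> ring_hom (sections X U) (sections X V)"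
    and restr_self:
      "\<lbrakk>openin (underlying X) U; s \<in> carrier (sections X U)\<rbrakk> \<Longrightarrow> restr X U U s = s"
    and restr_trans:
      "\<lbrakk>openin (underlying X) U; openin (underlying X) V; openin (underlying X) W;
        W \<subseteq> V; V \<subseteq> U; s \<in> carrier (sections X U)\<rbrakk>
        \<Longrightarrow> restr X V W (restr X U V s) = restr X U W s"

locale ringed_space = presheaf_of_rings X
  for X :: "('a, 'b) space_with_rings" +
  assumes locality:
      "\<lbrakk>\<And>V. V \<in> \<V> \<Longrightarrow> openin (underlying X) V;
        s \<in> carrier (sections X (\<Union>\<V>)); t \<in> carrier (sections X (\<Union>\<V>));
        \<And>V. V \<in> \<V> \<Longrightarrow> restr X (\<Union>\<V>) V s = restr X (\<Union>\<V>) V t\<rbrakk>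
        \<Longrightarrow> s = t"
    and gluing:
      "\<lbrakk>\<And>V. V \<in> \<V> \<Longrightarrow> openin (underlying X) V;
        \<And>V. V \<in> \<V> \<Longrightarrow> \<sigma> V \<in> carrier (sections X V);
        \<And>V W. \<lbrakk>V \<in> \<V>; W \<in> \<V>\<rbrakk> \<Longrightarrow> restr X V (V \<inter> W) (\<sigma> V) = restr X W (V \<inter> W) (\<sigma> W)\<rbrakk>
        \<Longrightarrow> \<exists>s \<in> carrier (sections X (\<Union>\<V>)). \<forall>V \<in> \<V>. restr X (\<Union>\<V>) V s = \<sigma> V"

definition germ ::
    "('a, 'b) space_with_rings \<Rightarrow> 'a \<Rightarrow> 'a set \<Rightarrow> 'b \<Rightarrow> ('a set \<times> 'b) set" where
  "germ X x U s =
     {(V, t). openin (underlying X) V \<and> x \<in> V \<and> t \<in> carrier (sections X V) \<and>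
        (\<exists>W. openin (underlying X) W \<and> x \<in> W \<and> W \<subseteq> U \<inter> V \<and> restr X U W s = restr X V W t)}"

definition stalk ::
    "('a, 'b) space_with_rings \<Rightarrow> 'a \<Rightarrow> ('a set \<times> 'b) set ring" where
  "stalk X x =
    \<lparr>carrier = {germ X x U s | U s.
                  openin (underlying X) U \<and> x \<in> U \<and> s \<in> carrier (sections X U)},
     mult = (\<lambda>A B. \<Union>(U, s) \<in> A. \<Union>(V, t) \<in> B.
               germ X x (U \<inter> V)
                 (restr X U (U \<inter> V) s \<otimes>\<^bsub>sections X (U \<inter> V)\<^esub> restr X V (U \<inter> V) t)),
     one = germ X x (topspace (underlying X)) \<one>\<^bsub>sections X (topspace (underlying X))\<^esub>,
     zero = germ X x (topspace (underlying X)) \<zero>\<^bsub>sections X (topspace (underlying X))\<^esub>,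
     add = (\<lambda>A B. \<Union>(U, s) \<in> A. \<Union>(V, t) \<in> B.
               germ X x (U \<inter> V)
                 (restr X U (U \<inter> V) s \<oplus>\<^bsub>sections X (U \<inter> V)\<^esub> restr X V (U \<inter> V) t))\<rparr>"

locale locally_ringed_space = ringed_space X
  for X :: "('a, 'b) space_with_rings" +
  assumes stalk_local: "x \<in> topspace (underlying X) \<Longrightarrow> local_ring (stalk X x)"

definition open_subspace ::
    "('a, 'b) space_with_rings \<Rightarrow> 'a set \<Rightarrow> ('a, 'b) space_with_rings" where
  "open_subspace X U = X\<lparr>underlying := subtopology (underlying X) U\<rparr>"


section \<open>Morphisms of locally ringed spaces\<close>

definition preim ::
    "('a, 'b) space_with_rings \<Rightarrow> ('a \<Rightarrow> 'c) \<Rightarrow> 'c set \<Rightarrow> 'a set" where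
  "preim X f V = {x \<in> topspace (underlying X). f x \<in> V}"

text \<open>A morphism \<open>X \<rightarrow> Y\<close> is a continuous map \<open>f\<close> with ring homomorphisms \<open>\<phi> V\<close> from
  \<open>sections Y V\<close> to \<open>sections X (preim X f V)\<close>. The induced map on stalks at \<open>x\<close> goes from
  \<open>stalk Y (f x)\<close> to \<open>stalk X x\<close>.\<close>

definition stalk_map ::
    "('a, 'b) space_with_rings \<Rightarrow> ('a \<Rightarrow> 'c) \<Rightarrow> ('c set \<Rightarrow> 'd \<Rightarrow> 'b) \<Rightarrow> 'a
      \<Rightarrow> ('c set \<times> 'd) set \<Rightarrow> ('a set \<times> 'b) set" where
  "stalk_map X f \<phi> x A = (\<Union>(V, t) \<in> A. germ X x (preim X f V) (\<phi> V t))"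

definition lrs_morphism ::
    "('a, 'b) space_with_rings \<Rightarrow> ('c, 'd) space_with_rings
      \<Rightarrow> ('a \<Rightarrow> 'c) \<Rightarrow> ('c set \<Rightarrow> 'd \<Rightarrow> 'b) \<Rightarrow> bool" where
  "lrs_morphism X Y f \<phi> \<longleftrightarrow>
     continuous_map (underlying X) (underlying Y) f \<and>
     (\<forall>V. openin (underlying Y) V \<longrightarrow>
        \<phi> V \<in> ring_hom (sections Y V) (sections X (preim X f V))) \<and>
     (\<forall>V W t. openin (underlying Y) V \<and> openin (underlying Y) W \<and> W \<subseteq> V \<and>
        t \<in> carrier (sections Y V) \<longrightarrow>
        \<phi> W (restr Y V W t) = restr X (preim X f V) (preim X f W) (\<phi> V t)) \<and>
     (\<forall>x \<in> topspace (underlying X).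
        stalk_map X f \<phi> x \<in> local_ring_hom (stalk Y (f x)) (stalk X x))"

text \<open>An isomorphism is a morphism with a two-sided inverse morphism. On sections, the composite of
  \<open>(f, \<phi>) : X \<rightarrow> Y\<close> and \<open>(g, \<psi>) : Y \<rightarrow> X\<close> is \<open>\<phi> (preim Y g U) \<circ> \<psi> U\<close>.\<close>

definition lrs_isomorphic ::
    "('a, 'b) space_with_rings \<Rightarrow> ('c, 'd) space_with_rings \<Rightarrow> bool" where
  "lrs_isomorphic X Y \<longleftrightarrow>
     (\<exists>f \<phi> g \<psi>. lrs_morphism X Y f \<phi> \<and> lrs_morphism Y X g \<psi> \<and>
        (\<forall>x \<in> topspace (underlying X). g (f x) = x) \<and>
        (\<forall>y \<in> topspace (underlying Y). f (g y) = y) \<and>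
        (\<forall>U. openin (underlying X) U \<longrightarrow>
           (\<forall>s \<in> carrier (sections X U). \<phi> (preim Y g U) (\<psi> U s) = s)) \<and>
        (\<forall>V. openin (underlying Y) V \<longrightarrow>
           (\<forall>t \<in> carrier (sections Y V). \<psi> (preim X f V) (\<phi> V t) = t)))"


section \<open>Affine schemes and schemes\<close>

definition prime_spectrum :: "('a, 'm) ring_scheme \<Rightarrow> 'a set set" where
  "prime_spectrum R = {P. primeideal P R}"

definition zariski_open :: "('a, 'm) ring_scheme \<Rightarrow> 'a set set \<Rightarrow> bool" where
  "zariski_open R U \<longleftrightarrow> (\<exists>E \<subseteq> carrier R. U = {P \<in> prime_spectrum R. \<not> E \<subseteq> P})"

lemma istopology_zariski_open: "istopology (zariski_open R)"
  unfolding istopology_def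
proof (intro conjI allI impI)
  fix U V assume "zariski_open R U" "zariski_open R V"
  then obtain E F where E: "E \<subseteq> carrier R" "U = {P \<in> prime_spectrum R. \<not> E \<subseteq> P}"
    and F: "F \<subseteq> carrier R" "V = {P \<in> prime_spectrum R. \<not> F \<subseteq> P}"
    unfolding zariski_open_def by auto
  define G where "G = {a \<otimes>\<^bsub>R\<^esub> b | a b. a \<in> E \<and> b \<in> F}"
  have prime: "(\<not> G \<subseteq> P) = (\<not> E \<subseteq> P \<and> \<not> F \<subseteq> P)" if "P \<in> prime_spectrum R" for P
  proof -
    interpret primeideal P R using that unfolding prime_spectrum_def by simp
    show ?thesis
    proof
      assume "\<not> G \<subseteq> P"
      then obtain a b where "a \<in> E" "b \<in> F" "a \<otimes>\<^bsub>R\<^esub> b \<notin> P"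
        unfolding G_def by auto
      then show "\<not> E \<subseteq> P \<and> \<not> F \<subseteq> P"
        using E(1) F(1) I_l_closed I_r_closed by (metis subsetD)
    next
      assume "\<not> E \<subseteq> P \<and> \<not> F \<subseteq> P"
      then obtain a b where ab: "a \<in> E" "b \<in> F" "a \<notin> P" "b \<notin> P" by auto
      then have "a \<otimes>\<^bsub>R\<^esub> b \<notin> P" using E(1) F(1) I_prime by (metis subsetD)
      moreover have "a \<otimes>\<^bsub>R\<^esub> b \<in> G" using ab unfolding G_def by auto
      ultimately show "\<not> G \<subseteq> P" by auto
    qed
  qed
  have G: "G \<subseteq> carrier R" if "P \<in> prime_spectrum R" for P
  proof -
    interpret primeideal P R using that unfolding prime_spectrum_def by simp
    show ?thesis using E(1) F(1) unfolding G_def by auto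
  qed
  have UV: "U \<inter> V = {P \<in> prime_spectrum R. \<not> G \<subseteq> P}"
    unfolding E(2) F(2) using prime by auto
  show "zariski_open R (U \<inter> V)"
  proof (cases "prime_spectrum R = {}")
    case True
    then have "U \<inter> V = {P \<in> prime_spectrum R. \<not> {} \<subseteq> P}" unfolding UV by auto
    then show ?thesis unfolding zariski_open_def by (intro exI[of _ "{}"]) auto
  next
    case False
    then have "G \<subseteq> carrier R" using G by blast
    then show ?thesis unfolding zariski_open_def using UV by (intro exI[of _ G]) simp
  qed
next
  fix \<U> assume "\<forall>U\<in>\<U>. zariski_open R U"
  then obtain E where E: "\<And>U. U \<in> \<U> \<Longrightarrow> E U \<subseteq> carrier R"
      "\<And>U. U \<in> \<U> \<Longrightarrow> U = {P \<in> prime_spectrum R. \<not> E U \<subseteq> P}"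
    unfolding zariski_open_def by metis
  have "\<Union>\<U> = {P \<in> prime_spectrum R. \<not> (\<Union>U\<in>\<U>. E U) \<subseteq> P}"
    using E(2) by blast
  with E(1) show "zariski_open R (\<Union>\<U>)"
    unfolding zariski_open_def by (intro exI[of _ "\<Union>U\<in>\<U>. E U"]) blast
qed

definition zariski_topology :: "('a, 'm) ring_scheme \<Rightarrow> 'a set topology" where
  "zariski_topology R = topology (zariski_open R)"

lemma openin_zariski_topology: "openin (zariski_topology R) U \<longleftrightarrow> zariski_open R U"
  unfolding zariski_topology_def by (simp add: istopology_zariski_open topology_inverse')

abbreviation prime_localization ::
    "('a, 'm) ring_scheme \<Rightarrow> 'a set \<Rightarrow> ('a \<times> 'a) set ring" where
  "prime_localization R P \<equiv> localization R (carrier R - P)"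

text \<open>A section over \<open>U\<close> assigns to each \<open>P \<in> U\<close> an element of the localization at \<open>P\<close>, and is locally
  given by a single fraction. It is \<open>undefined\<close> outside \<open>U\<close>.\<close>

definition spec_sections ::
    "('a, 'm) ring_scheme \<Rightarrow> 'a set set \<Rightarrow> ('a set \<Rightarrow> ('a \<times> 'a) set) ring" where
  "spec_sections R U =
    \<lparr>carrier = {s \<in> \<Pi>\<^sub>E P \<in> U. carrier (prime_localization R P).
        \<forall>P \<in> U. \<exists>V. zariski_open R V \<and> P \<in> V \<and> V \<subseteq> U \<and>
          (\<exists>a \<in> carrier R. \<exists>r \<in> carrier R.
             \<forall>Q \<in> V. r \<notin> Q \<and> s Q = fraction R (carrier R - Q) a r)},
     mult = (\<lambda>s t. \<lambda>P \<in> U. s P \<otimes>\<^bsub>prime_localization R P\<^esub> t P),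
     one = (\<lambda>P \<in> U. \<one>\<^bsub>prime_localization R P\<^esub>),
     zero = (\<lambda>P \<in> U. \<zero>\<^bsub>prime_localization R P\<^esub>),
     add = (\<lambda>s t. \<lambda>P \<in> U. s P \<oplus>\<^bsub>prime_localization R P\<^esub> t P)\<rparr>"

definition Spec ::
    "('a, 'm) ring_scheme \<Rightarrow> ('a set, 'a set \<Rightarrow> ('a \<times> 'a) set) space_with_rings" where
  "Spec R =
    \<lparr>underlying = zariski_topology R,
     sections = spec_sections R,
     restr = (\<lambda>U V s. restrict s V)\<rparr>"

text \<open>The ring may be taken with elements in the type \<open>'b\<close> of sections without loss of generality:
  if \<open>X\<close> is isomorphic to the spectrum of any ring, that ring is isomorphic to the ring of global
  sections of \<open>X\<close>.\<close>

definition affine_scheme :: "('a, 'b) space_with_rings \<Rightarrow> bool" where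
  "affine_scheme X \<longleftrightarrow>
     locally_ringed_space X \<and> (\<exists>R :: 'b ring. cring R \<and> lrs_isomorphic X (Spec R))"

definition affine_open :: "('a, 'b) space_with_rings \<Rightarrow> 'a set \<Rightarrow> bool" where
  "affine_open X U \<longleftrightarrow> openin (underlying X) U \<and> affine_scheme (open_subspace X U)"

locale scheme = locally_ringed_space X
  for X :: "('a, 'b) space_with_rings" +
  assumes locally_affine: "x \<in> topspace (underlying X) \<Longrightarrow> \<exists>U. x \<in> U \<and> affine_open X U"

definition affine_open_covering ::
    "('a, 'b) space_with_rings \<Rightarrow> 'a set set \<Rightarrow> bool" where
  "affine_open_covering X \<U> \<longleftrightarrow>
     (\<forall>U \<in> \<U>. affine_open X U) \<and> \<Union>\<U> = topspace (underlying X)"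

end

theory Submission
  imports Defs "HOL-Algebra.Ring_Divisibility"
begin

text \<open>
  A Hausdorff space always has closed points. Conversely, if the points of \<open>X\<close> are closed, they are
  closed in every affine open, so the matter splits into a fact about rings and a fact about
  gluing.

  For a commutative ring \<open>R\<close>, closed points in \<open>Spec R\<close> mean that no prime lies strictly inside
  another one. Given distinct primes \<open>P\<close> and \<open>Q\<close>, choose \<open>f \<in> P - Q\<close>. Since \<open>P\<close> is minimal, \<open>f\<close> is
  nilpotent in the local ring at \<open>P\<close>: some \<open>s \<notin> P\<close> satisfies \<open>s f\<^sup>n = 0\<close>. Then the basic open sets of
  \<open>s\<close> and of \<open>f\<close> are disjoint, and they separate \<open>P\<close> from \<open>Q\<close>
  (\<open>t1_spectrum_imp_Hausdorff\<close>). Minimality enters through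
  \<open>cring.primeideal_avoiding_submonoid\<close>: if no product \<open>s f\<^sup>n\<close> with \<open>s \<notin> P\<close> vanished, some prime
  would avoid all of them, hence lie inside \<open>P\<close> and miss \<open>f\<close>.

  Thus \<open>X\<close> is covered by Hausdorff open sets, which alone does not make \<open>X\<close> Hausdorff (the line with
  doubled origin). Quasi-compactness of the overlaps repairs this: \<open>U \<inter> V\<close> is compact in the
  Hausdorff space \<open>V\<close>, so it is closed there, and \<open>V - U\<close> is an open set that separates the points of
  \<open>V\<close> outside \<open>U\<close> from the points of \<open>U\<close> (\<open>Hausdorff_space_open_cover\<close>).
\<close>

section \<open>Prime ideals avoiding a multiplicative set\<close>

text \<open>An ideal maximal among those avoiding \<open>S\<close> is prime: if it contained neither \<open>a\<close> nor \<open>b\<close>, then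
  adjoining \<open>a\<close>, and likewise \<open>b\<close>, would produce an element of \<open>S\<close>, and the product of these two
  elements would lie in the ideal as soon as \<open>a \<otimes> b\<close> does.\<close>

lemma (in cring) primeideal_avoiding_submonoid:
  assumes S: "submonoid S R" and zero: "\<zero> \<notin> S"
  obtains Q where "primeideal Q R" "Q \<inter> S = {}"
proof -
  define \<A> where "\<A> = {I. ideal I R \<and> I \<inter> S = {}}"
  have "\<exists>M\<in>\<A>. \<forall>X\<in>\<A>. M \<subseteq> X \<longrightarrow> X = M"
  proof (rule subset_Zorn_nonempty)
    show "\<A> \<noteq> {}"
      using zeroideal zero unfolding \<A>_def by blast
  next
    fix \<C> assume ne: "\<C> \<noteq> {}" and ch: "subset.chain \<A> \<C>"
    then have "subset.chain {I. ideal I R} \<C>"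
      unfolding \<A>_def subset_chain_def by blast
    from chain_Union_is_ideal[OF this] ne have "ideal (\<Union>\<C>) R"
      by simp
    moreover have "\<Union>\<C> \<inter> S = {}"
      using ch unfolding \<A>_def subset_chain_def by blast
    ultimately show "\<Union>\<C> \<in> \<A>"
      unfolding \<A>_def by simp
  qed
  then obtain M where "M \<in> \<A>" and maximal: "\<forall>X\<in>\<A>. M \<subseteq> X \<longrightarrow> X = M"
    by (elim bexE)
  then have M: "ideal M R" "M \<inter> S = {}"
    unfolding \<A>_def by simp_all
  have max: "I = M" if "ideal I R" "I \<inter> S = {}" "M \<subseteq> I" for I
    using maximal that unfolding \<A>_def by simp
  interpret M: ideal M R by (rule M(1))
  have meets: "\<exists>m\<in>M. \<exists>x\<in>carrier R. m \<oplus> x \<otimes> a \<in> S" if a: "a \<in> carrier R" "a \<notin> M" for a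
  proof -
    have I: "ideal (set_add R M (PIdl a)) R"
      by (rule add_ideals[OF M(1) cgenideal_ideal[OF a(1)]])
    have "m \<in> set_add R M (PIdl a)" if "m \<in> M" for m
    proof -
      have "m = m \<oplus> \<zero> \<otimes> a"
        using M.Icarr[OF that] a(1) by simp
      then show ?thesis
        using that unfolding set_add_def' cgenideal_def by blast
    qed
    moreover have "a \<in> set_add R M (PIdl a)"
    proof -
      have "a = \<zero> \<oplus> \<one> \<otimes> a"
        using a(1) by simp
      then show ?thesis
        using M.zero_closed unfolding set_add_def' cgenideal_def by blast
    qed
    ultimately have "set_add R M (PIdl a) \<inter> S \<noteq> {}"
      using max[OF I] a(2) by blast
    then show ?thesis
      unfolding set_add_def' cgenideal_def by blast
  qed
  have "primeideal M R"
  proof (rule primeidealI[OF M(1) is_cring])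
    show "carrier R \<noteq> M"
      using M(2) submonoid.one_closed[OF S] by auto
  next
    fix a b assume a: "a \<in> carrier R" and b: "b \<in> carrier R" and ab: "a \<otimes> b \<in> M"
    show "a \<in> M \<or> b \<in> M"
    proof (rule ccontr)
      assume "\<not> (a \<in> M \<or> b \<in> M)"
      with meets a b obtain m x n y where
        m: "m \<in> M" "x \<in> carrier R" "m \<oplus> x \<otimes> a \<in> S" and
        n: "n \<in> M" "y \<in> carrier R" "n \<oplus> y \<otimes> b \<in> S"
        by meson
      note mc = M.Icarr[OF m(1)] and nc = M.Icarr[OF n(1)]
      have "(m \<oplus> x \<otimes> a) \<otimes> (n \<oplus> y \<otimes> b)
          = m \<otimes> (n \<oplus> y \<otimes> b) \<oplus> (x \<otimes> a \<otimes> n \<oplus> x \<otimes> y \<otimes> (a \<otimes> b))"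
        using a b m(2) n(2) mc nc by algebra
      also have "\<dots> \<in> M"
      proof (intro M.a_closed)
        show "m \<otimes> (n \<oplus> y \<otimes> b) \<in> M"
          using b n(2) nc by (intro M.I_r_closed[OF m(1)]) simp
        show "x \<otimes> a \<otimes> n \<in> M"
          using a m(2) by (intro M.I_l_closed[OF n(1)]) simp
        show "x \<otimes> y \<otimes> (a \<otimes> b) \<in> M"
          using m(2) n(2) by (intro M.I_l_closed[OF ab]) simp
      qed
      finally show False
        using M(2) submonoid.m_closed[OF S m(3) n(3)] by blast
    qed
  qed
  with M(2) that show thesis by blast
qed

section \<open>Spectra with closed points\<close>

lemma topspace_zariski_topology: "topspace (zariski_topology R) = prime_spectrum R"
proof
  show "topspace (zariski_topology R) \<subseteq> prime_spectrum R"
    using openin_topspace[of "zariski_topology R"]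
    unfolding openin_zariski_topology zariski_open_def by blast
  have "carrier R \<noteq> P \<and> P \<subseteq> carrier R" if "P \<in> prime_spectrum R" for P
    using that primeideal.I_notcarr[of P R] ideal.Icarr[OF primeideal.axioms(1), of P R]
    unfolding prime_spectrum_def by blast
  then have "prime_spectrum R = {P \<in> prime_spectrum R. \<not> carrier R \<subseteq> P}"
    by blast
  then have "openin (zariski_topology R) (prime_spectrum R)"
    unfolding openin_zariski_topology zariski_open_def by blast
  then show "prime_spectrum R \<subseteq> topspace (zariski_topology R)"
    by (rule openin_subset)
qed

lemma openin_basic_open:
  assumes "f \<in> carrier R"
  shows "openin (zariski_topology R) {P \<in> prime_spectrum R. f \<notin> P}"
  unfolding openin_zariski_topology zariski_open_def
  using assms by (intro exI[of _ "{f}"]) auto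

text \<open>The closure of a prime consists of the primes containing it.\<close>

lemma t1_spectrum_no_inclusions:
  assumes t1: "t1_space (zariski_topology R)"
    and Q: "primeideal Q R" and P: "primeideal P R" and sub: "Q \<subseteq> P"
  shows "Q = P"
proof (rule ccontr)
  assume "Q \<noteq> P"
  with t1 P Q obtain U where U: "openin (zariski_topology R) U" "P \<in> U" "Q \<notin> U"
    unfolding t1_space_def topspace_zariski_topology prime_spectrum_def by blast
  then obtain E where "U = {P \<in> prime_spectrum R. \<not> E \<subseteq> P}"
    unfolding openin_zariski_topology zariski_open_def by blast
  with U Q sub show False
    unfolding prime_spectrum_def by blast
qed

text \<open>This says that \<open>f\<close> is nilpotent in the localization at a minimal prime \<open>P\<close>, where \<open>P\<close> generates
  the only prime ideal. Working with the products \<open>s f\<^sup>n\<close> inside \<open>R\<close> avoids the localization.\<close>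

lemma (in cring) locally_nilpotent_at_minimal_prime:
  assumes P: "primeideal P R" and f: "f \<in> P"
    and minimal: "\<And>Q. \<lbrakk>primeideal Q R; Q \<subseteq> P\<rbrakk> \<Longrightarrow> Q = P"
  obtains s n where "s \<in> carrier R - P" "s \<otimes> f [^] (n::nat) = \<zero>"
proof (rule ccontr)
  assume "\<not> thesis"
  with that have nonzero: "s \<otimes> f [^] n \<noteq> \<zero>" if "s \<in> carrier R - P" for s and n :: nat
    using \<open>s \<in> carrier R - P\<close> by blast
  interpret P: primeideal P R by (rule P)
  have fc: "f \<in> carrier R" by (rule P.Icarr[OF f])
  have one: "\<one> \<in> carrier R - P"
    using P.one_imp_carrier P.I_notcarr by auto
  define S where "S = {s \<otimes> f [^] n | s n. s \<in> carrier R - P \<and> n \<in> (UNIV :: nat set)}"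
  have "submonoid S R"
  proof
    show "S \<subseteq> carrier R"
      unfolding S_def using fc by auto
    have "\<one> = \<one> \<otimes> f [^] (0::nat)"
      by simp
    then show "\<one> \<in> S"
      unfolding S_def using one by blast
  next
    fix u v assume "u \<in> S" "v \<in> S"
    then obtain s t and m n :: nat where
      s: "s \<in> carrier R" "s \<notin> P" "u = s \<otimes> f [^] m" and
      t: "t \<in> carrier R" "t \<notin> P" "v = t \<otimes> f [^] n"
      unfolding S_def by auto
    have "u \<otimes> v = (s \<otimes> t) \<otimes> (f [^] m \<otimes> f [^] n)"
      using s t fc by (simp add: m_ac)
    then have "u \<otimes> v = (s \<otimes> t) \<otimes> f [^] (m + n)"
      by (simp add: nat_pow_mult[OF fc])
    moreover have "s \<otimes> t \<in> carrier R - P"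
      using s t P.I_prime by auto
    ultimately show "u \<otimes> v \<in> S"
      unfolding S_def by blast
  qed
  moreover have "\<zero> \<notin> S"
  proof
    assume "\<zero> \<in> S"
    then obtain s and n :: nat where "s \<in> carrier R - P" "\<zero> = s \<otimes> f [^] n"
      unfolding S_def by blast
    then show False
      using nonzero[of s n] by simp
  qed
  ultimately obtain Q where Q: "primeideal Q R" "Q \<inter> S = {}"
    by (rule primeideal_avoiding_submonoid)
  \<comment> \<open>\<open>S\<close> contains the complement of \<open>P\<close> (take \<open>n = 0\<close>), so \<open>Q \<subseteq> P\<close>; it also contains \<open>f\<close>.\<close>
  have "s \<in> S" if "s \<in> carrier R - P" for s
  proof -
    have "s = s \<otimes> f [^] (0::nat)"
      using that by simp
    then show ?thesis
      unfolding S_def using that by blast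
  qed
  moreover have "Q \<subseteq> carrier R"
    using ideal.Icarr[OF primeideal.axioms(1)[OF Q(1)]] by blast
  ultimately have "Q = P"
    using minimal[OF Q(1)] Q(2) by blast
  moreover have "f \<in> S"
  proof -
    have "f = \<one> \<otimes> f [^] (1::nat)"
      using fc by simp
    then show ?thesis
      unfolding S_def using one by blast
  qed
  ultimately show False
    using f Q(2) by blast
qed

lemma (in primeideal) prime_nat_pow:
  "\<lbrakk>f \<in> carrier R; f [^] (n::nat) \<in> I\<rbrakk> \<Longrightarrow> f \<in> I"
proof (induction n)
  case 0
  then show ?case using one_imp_carrier I_notcarr by simp
next
  case (Suc n)
  then show ?case using I_prime[of "f [^] n" f] by auto
qed

lemma t1_spectrum_imp_Hausdorff:
  fixes R (structure)
  assumes "cring R" and t1: "t1_space (zariski_topology R)"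
  shows "Hausdorff_space (zariski_topology R)"
  unfolding Hausdorff_space_def topspace_zariski_topology
proof (intro allI impI, elim conjE)
  interpret cring R by fact
  fix P Q assume "P \<in> prime_spectrum R" "Q \<in> prime_spectrum R" and ne: "P \<noteq> Q"
  then have P: "primeideal P R" and Q: "primeideal Q R"
    unfolding prime_spectrum_def by auto
  obtain f where f: "f \<in> P" "f \<notin> Q"
    using t1_spectrum_no_inclusions[OF t1 P Q] ne by blast
  have fc: "f \<in> carrier R"
    by (rule ideal.Icarr[OF primeideal.axioms(1)[OF P] f(1)])
  obtain s and n :: nat where s: "s \<in> carrier R - P" "s \<otimes> f [^] n = \<zero>"
    using locally_nilpotent_at_minimal_prime[OF P f(1)] t1_spectrum_no_inclusions[OF t1 _ P]
    by metis
  have sf: "s \<in> I \<or> f \<in> I" if "primeideal I R" for I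
  proof -
    interpret I: primeideal I R by (rule that)
    have "s \<otimes> f [^] n \<in> I"
      using s(2) I.zero_closed by simp
    then show ?thesis
      using I.I_prime[of s "f [^] n"] I.prime_nat_pow[OF fc] s(1) fc by auto
  qed
  define D where "D g = {I \<in> prime_spectrum R. g \<notin> I}" for g
  have "openin (zariski_topology R) (D s)" "openin (zariski_topology R) (D f)"
    unfolding D_def using s(1) fc openin_basic_open by auto
  moreover have "P \<in> D s" "Q \<in> D f" "disjnt (D s) (D f)"
    using P Q s(1) f(2) sf unfolding D_def prime_spectrum_def disjnt_def by auto
  ultimately show "\<exists>U V. openin (zariski_topology R) U \<and> openin (zariski_topology R) V
      \<and> P \<in> U \<and> Q \<in> V \<and> disjnt U V"
    by blast
qed

section \<open>Affine schemes with closed points\<close>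

lemma lrs_isomorphic_imp_homeomorphic_space:
  assumes "lrs_isomorphic X Y"
  shows "underlying X homeomorphic_space underlying Y"
proof -
  from assms obtain f \<phi> g \<psi> where
    f: "lrs_morphism X Y f \<phi>" and g: "lrs_morphism Y X g \<psi>" and
    inverse: "\<forall>x \<in> topspace (underlying X). g (f x) = x"
      "\<forall>y \<in> topspace (underlying Y). f (g y) = y"
    unfolding lrs_isomorphic_def by (elim exE conjE)
  have "continuous_map (underlying X) (underlying Y) f"
    using f unfolding lrs_morphism_def by (elim conjE)
  moreover have "continuous_map (underlying Y) (underlying X) g"
    using g unfolding lrs_morphism_def by (elim conjE)
  ultimately have "homeomorphic_maps (underlying X) (underlying Y) f g"
    unfolding homeomorphic_maps_def using inverse by (intro conjI)
  then show ?thesis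
    by (rule homeomorphic_maps_imp_homeomorphic_space)
qed

lemma t1_affine_scheme_imp_Hausdorff:
  assumes "affine_scheme X" and "t1_space (underlying X)"
  shows "Hausdorff_space (underlying X)"
proof -
  from assms(1) obtain R :: "'b ring" where "cring R" and "lrs_isomorphic X (Spec R)"
    unfolding affine_scheme_def by blast
  then have homeo: "underlying X homeomorphic_space zariski_topology R"
    using lrs_isomorphic_imp_homeomorphic_space[of X "Spec R"] unfolding Spec_def by simp
  then have "t1_space (zariski_topology R)"
    using assms(2) homeomorphic_t1_space by blast
  then have "Hausdorff_space (zariski_topology R)"
    by (rule t1_spectrum_imp_Hausdorff[OF \<open>cring R\<close>])
  then show ?thesis
    using homeo homeomorphic_Hausdorff_space by blast
qed

section \<open>Gluing Hausdorff spaces with compact overlaps\<close>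

text \<open>Two points in a common member of the cover are separated inside it. Otherwise \<open>x \<in> U\<close> and
  \<open>y \<in> V - U\<close>, and \<open>V - U\<close> itself is open, because the compact set \<open>U \<inter> V\<close> is closed in the Hausdorff
  space \<open>V\<close>.\<close>

lemma Hausdorff_space_open_cover:
  assumes cover: "\<Union>\<U> = topspace T"
    and open_cover: "\<And>U. U \<in> \<U> \<Longrightarrow> openin T U"
    and Hausdorff: "\<And>U. U \<in> \<U> \<Longrightarrow> Hausdorff_space (subtopology T U)"
    and compact: "\<And>U V. \<lbrakk>U \<in> \<U>; V \<in> \<U>\<rbrakk> \<Longrightarrow> compactin T (U \<inter> V)"
  shows "Hausdorff_space T"
  unfolding Hausdorff_space_def
proof (intro allI impI, elim conjE)
  fix x y assume "x \<in> topspace T" "y \<in> topspace T" and ne: "x \<noteq> y"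
  then obtain U V where U: "U \<in> \<U>" "x \<in> U" and V: "V \<in> \<U>" "y \<in> V"
    using cover by blast
  note opens = open_cover[OF U(1)] open_cover[OF V(1)]
  show "\<exists>A B. openin T A \<and> openin T B \<and> x \<in> A \<and> y \<in> B \<and> disjnt A B"
  proof (cases "y \<in> U")
    case True
    have "x \<in> topspace (subtopology T U)" "y \<in> topspace (subtopology T U)"
      using U(2) True openin_subset[OF opens(1)] by auto
    then obtain A B where "openin (subtopology T U) A" "openin (subtopology T U) B"
      "x \<in> A" "y \<in> B" "disjnt A B"
      using Hausdorff[OF U(1)] ne unfolding Hausdorff_space_def by meson
    then show ?thesis
      using opens(1) by (meson openin_trans_full)
  next
    case False
    have "compactin (subtopology T V) (U \<inter> V)"
      using compact[OF U(1) V(1)] by (simp add: compactin_subtopology)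
    then have "closedin (subtopology T V) (U \<inter> V)"
      by (rule compactin_imp_closedin[OF Hausdorff[OF V(1)]])
    then have "openin (subtopology T V) (topspace (subtopology T V) - U \<inter> V)"
      by (simp add: closedin_def)
    moreover have "topspace (subtopology T V) - U \<inter> V = V - U"
      using openin_subset[OF opens(2)] by auto
    ultimately have "openin T (V - U)"
      using opens(2) by (metis openin_trans_full)
    then show ?thesis
      using opens(1) U(2) V(2) False by (intro exI[of _ U] exI[of _ "V - U"]) (auto simp: disjnt_def)
  qed
qed

theorem corollary3p6:
  fixes X :: "('a, 'b) space_with_rings"
  assumes "scheme X"
    and "\<exists>\<U>. affine_open_covering X \<U> \<and>
           (\<forall>U \<in> \<U>. \<forall>V \<in> \<U>. compactin (underlying X) (U \<inter> V))"
  shows "Hausdorff_space (underlying X) \<longleftrightarrow>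
          (\<forall>x \<in> topspace (underlying X). closedin (underlying X) {x})"
proof
  assume "Hausdorff_space (underlying X)"
  then show "\<forall>x \<in> topspace (underlying X). closedin (underlying X) {x}"
    by (simp add: Hausdorff_imp_t1_space flip: t1_space_closedin_singleton)
next
  assume "\<forall>x \<in> topspace (underlying X). closedin (underlying X) {x}"
  then have t1: "t1_space (underlying X)"
    by (simp add: t1_space_closedin_singleton)
  from assms(2) obtain \<U> where cover: "affine_open_covering X \<U>"
    and compact: "\<And>U V. \<lbrakk>U \<in> \<U>; V \<in> \<U>\<rbrakk> \<Longrightarrow> compactin (underlying X) (U \<inter> V)"
    by blast
  show "Hausdorff_space (underlying X)"
  proof (rule Hausdorff_space_open_cover[OF _ _ _ compact])
    show "\<Union>\<U> = topspace (underlying X)"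
      using cover unfolding affine_open_covering_def by blast
  next
    fix U assume "U \<in> \<U>"
    then have U: "affine_open X U"
      using cover unfolding affine_open_covering_def by blast
    then show "openin (underlying X) U"
      unfolding affine_open_def by blast
    have "t1_space (underlying (open_subspace X U))"
      using t1 unfolding open_subspace_def by (simp add: t1_space_subtopology)
    then have "Hausdorff_space (underlying (open_subspace X U))"
      using U t1_affine_scheme_imp_Hausdorff unfolding affine_open_def by blast
    then show "Hausdorff_space (subtopology (underlying X) U)"
      unfolding open_subspace_def by simp
  qed
qed

end
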